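(* Let $a>0$, $V_1=(-a,0)$, $V_2=(a,0)$ and $P(t)=a(\cos t,\sin t)$, $t\in[0,2\pi)$. The loci of the two Brocard points of the triangle $V_1V_2P(t)$ are a pair of (teardrop-shaped) closed curves that are inversely identical (one is the image of the other under an orientation-reversing isometry of the plane), each enclosing area $\frac{\pi a^2}{\sqrt5}$. One of them has a cusp at $V_1$ and the other has a cusp at $V_2$; the one with a cusp at $V_2$ is given by the quartic $$(x^2+y^2)^2-2a\,x\,(x^2+y^2)+4a^2y^2+2a^3x-a^4=0,$$ which for $a=1$ reads $x^4-2x^3+2y^2x^2+2x-2y^2x-1+y^4+4y^2=0$.
   Context: Brocard points: for a triangle with labelled vertices $A,B,C$, the two Brocard points are the unique interior points $\Omega_1,\Omega_2$ with $\angle\Omega_1AB=\angle\Omega_1BC=\angle\Omega_1CA$ and $\angle\Omega_2BA=\angle\Omega_2CB=\angle\Omega_2AC$. Here $(A,B,C)=(V_1,V_2,P(t))$, and the names $\Omega_1,\Omega_2$ are kept fixed by the labels as $P(t)$ moves. At the finitely many values of $t$ for which the triangle is degenerate, the Brocard points are understood as limits. "Teardrop" is a descriptive term for the shape of the curves. The area enclosed by a closed curve is the absolute value of $\frac12\oint(x\,dy-y\,dx)$ over one revolution of $t$. *)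

theory Defs
  imports "HOL-Analysis.Analysis"
begin

definition plane_angle :: "real^2 \<Rightarrow> real^2 \<Rightarrow> real^2 \<Rightarrow> real" where
  \<comment> \<open>The unoriented angle \<open>XYZ\<close> with vertex \<open>Y\<close>; only meaningful for \<open>X \<noteq> Y \<noteq> Z\<close>.\<close>
  "plane_angle X Y Z = arccos (((X - Y) \<bullet> (Z - Y)) / (norm (X - Y) * norm (Z - Y)))"

text \<open>For a non-degenerate triangle \<open>A, B, C\<close>, each of the two conditions below is satisfied by
  exactly one interior point. The labelling is what tells the two Brocard points apart, as the
  angles are unoriented.\<close>

definition brocard_point1 :: "real^2 \<Rightarrow> real^2 \<Rightarrow> real^2 \<Rightarrow> real^2" where
  "brocard_point1 A B C = (THE \<Omega>. \<Omega> \<in> interior (convex hull {A, B, C}) \<and>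
     plane_angle \<Omega> A B = plane_angle \<Omega> B C \<and> plane_angle \<Omega> B C = plane_angle \<Omega> C A)"

definition brocard_point2 :: "real^2 \<Rightarrow> real^2 \<Rightarrow> real^2 \<Rightarrow> real^2" where
  "brocard_point2 A B C = (THE \<Omega>. \<Omega> \<in> interior (convex hull {A, B, C}) \<and>
     plane_angle \<Omega> B A = plane_angle \<Omega> C B \<and> plane_angle \<Omega> C B = plane_angle \<Omega> A C)"

text \<open>A triangle point \<open>F\<close> followed along the triangles \<open>A, B, P t\<close>. The filter \<open>at t\<close> excludes
  \<open>t\<close> itself, so that an isolated degenerate triangle is assigned the limit of \<open>F\<close> over the
  neighbouring non-degenerate ones.\<close>

definition point_curve ::
  "(real^2 \<Rightarrow> real^2 \<Rightarrow> real^2 \<Rightarrow> real^2) \<Rightarrow> real^2 \<Rightarrow> real^2 \<Rightarrow> (real \<Rightarrow> real^2) \<Rightarrow> real \<Rightarrow> real^2" where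
  "point_curve F A B P t =
     (if collinear {A, B, P t} then Lim (at t) (\<lambda>s. F A B (P s)) else F A B (P t))"

definition enclosed_area :: "(real \<Rightarrow> real^2) \<Rightarrow> real" where
  "enclosed_area \<gamma> = \<bar>1 / 2 * integral {0..2*pi}
     (\<lambda>t. \<gamma> t $ 1 * vector_derivative \<gamma> (at t) $ 2 - \<gamma> t $ 2 * vector_derivative \<gamma> (at t) $ 1)\<bar>"

text \<open>\<open>f x - f 0\<close> is the linear part of the isometry \<open>f\<close>.\<close>

definition orientation_reversing_isometry :: "(real^2 \<Rightarrow> real^2) \<Rightarrow> bool" where
  "orientation_reversing_isometry f \<longleftrightarrow>
     (\<forall>x y. dist (f x) (f y) = dist x y) \<and> det (matrix (\<lambda>x. f x - f 0)) < 0"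

text \<open>The curve comes to rest at the parameter \<open>t\<close> and its unit tangent vector reverses there.
  Local injectivity excludes a curve that merely runs back along the arc it came from.\<close>

definition cusp_at :: "(real \<Rightarrow> real^2) \<Rightarrow> real \<Rightarrow> bool" where
  "cusp_at \<gamma> t \<longleftrightarrow>
     (\<forall>\<^sub>F s in nhds t. \<gamma> differentiable (at s)) \<and>
     (\<exists>e>0. inj_on \<gamma> {t-e..t+e}) \<and>
     vector_derivative \<gamma> (at t) = 0 \<and>
     (\<exists>T. norm T = 1 \<and>
        ((\<lambda>s. sgn (vector_derivative \<gamma> (at s))) \<longlongrightarrow> T) (at_right t) \<and>
        ((\<lambda>s. sgn (vector_derivative \<gamma> (at s))) \<longlongrightarrow> - T) (at_left t))"

definition has_cusp :: "(real \<Rightarrow> real^2) \<Rightarrow> real^2 \<Rightarrow> bool" where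
  "has_cusp \<gamma> p \<longleftrightarrow> (\<exists>t\<in>{0..<2*pi}. \<gamma> t = p \<and> cusp_at \<gamma> t)"

definition brocard_quartic :: "real \<Rightarrow> real \<Rightarrow> real \<Rightarrow> real" where
  "brocard_quartic a x y =
     (x^2 + y^2)^2 - 2 * a * x * (x^2 + y^2) + 4 * a^2 * y^2 + 2 * a^3 * x - a^4"

end

theory Submission
  imports Defs
begin

text \<open>The first Brocard point of a triangle \<open>A B C\<close> has barycentric coordinates
  \<open>1 / CA\<^sup>2 : 1 / AB\<^sup>2 : 1 / BC\<^sup>2\<close>, and the second one arises by exchanging \<open>A\<close> and \<open>B\<close>
  (\<open>brocard_point1_barycentric\<close>, \<open>brocard_point2_swap\<close>). The point of the proof is uniqueness:
  the three angle conditions force a cubic equation for the common cotangent, one side of which is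
  strictly monotone in the relevant range (\<open>brocard_angles_iff_ratios\<close>).

  When \<open>A B\<close> is a diameter of the circle and \<open>C = a (c, s)\<close> with \<open>c\<^sup>2 + s\<^sup>2 = 1\<close>, the two points become
  \<open>(a (4 c - \<epsilon> s\<^sup>2) / (4 + s\<^sup>2), 2 a (1 + \<epsilon> c) s / (4 + s\<^sup>2))\<close>
  with \<open>\<epsilon> = 1\<close> for the first and \<open>\<epsilon> = - 1\<close> for the second (\<open>brocard_thales\<close>). These formulas
  are smooth through the degenerate triangles \<open>s = 0\<close>, and the rest is read off from them.
  The substitution \<open>c \<mapsto> - c\<close>, \<open>\<epsilon> \<mapsto> - \<epsilon>\<close> reflects the point in the \<open>y\<close>-axis, which makes the
  curves congruent. Up to a term with integral \<open>0\<close>, the area integrand is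
  \<open>2 a\<^sup>2 / (4 + sin\<^sup>2 t)\<close>. At \<open>(- \<epsilon> a, 0)\<close> the velocity is \<open>sin t\<close> times a nonvanishing
  continuous vector, so that point is a cusp. Finally, the chord from the cusp to the point of
  parameter \<open>(c, s)\<close> has slope \<open>\<epsilon> s / 2\<close> (\<open>brocard_xy_chord\<close>). This inverts the parametrisation:
  the curve is injective over a period, and in terms of the recovered \<open>c\<close> and \<open>s\<close> the equation
  \<open>c\<^sup>2 + s\<^sup>2 = 1\<close> is the quartic (\<open>brocard_quartic_at_cusp\<close>).\<close>

section \<open>Angles in the plane\<close>

definition cross2 :: "real^2 \<Rightarrow> real^2 \<Rightarrow> real" where
  "cross2 u v = u$1 * v$2 - u$2 * v$1"

lemma norm_mult_norm_eq: "norm u * norm v = sqrt ((u \<bullet> v)\<^sup>2 + (cross2 u v)\<^sup>2)"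
proof -
  have "(norm u * norm v)\<^sup>2 = (u \<bullet> v)\<^sup>2 + (cross2 u v)\<^sup>2"
    unfolding power_mult_distrib power2_norm_eq_inner
    by (simp add: inner_vec_def sum_2 cross2_def algebra_simps power2_eq_square)
  then show ?thesis
    by (metis norm_ge_zero mult_nonneg_nonneg real_sqrt_unique)
qed

lemma collinear_iff_cross2: "collinear {A, B, C} \<longleftrightarrow> cross2 (A - B) (C - B) = 0"
proof -
  have "collinear {A, B, C} \<longleftrightarrow> \<bar>(A - B) \<bullet> (C - B)\<bar> = norm (A - B) * norm (C - B)"
    by (simp add: collinear_3 norm_cauchy_schwarz_equal)
  also have "\<dots> \<longleftrightarrow> cross2 (A - B) (C - B) = 0"
    unfolding norm_mult_norm_eq
    by (smt (verit) real_sqrt_abs real_sqrt_eq_iff zero_eq_power2)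
  finally show ?thesis .
qed

text \<open>The unoriented angle has cotangent \<open>(u \<bullet> v) / \<bar>u \<times> v\<bar>\<close>. Since \<open>cot\<close> is
  injective on the open interval from \<open>0\<close> to \<open>pi\<close>, equalities of angles become equalities of
  rational expressions in the coordinates.\<close>

lemma plane_angle_eq_arctan:
  assumes "cross2 (X - Y) (Z - Y) \<noteq> 0"
  shows "plane_angle X Y Z = pi / 2 - arctan ((X - Y) \<bullet> (Z - Y) / \<bar>cross2 (X - Y) (Z - Y)\<bar>)"
proof -
  define d w where "d = (X - Y) \<bullet> (Z - Y)" and "w = \<bar>cross2 (X - Y) (Z - Y)\<bar>"
  have "w > 0" using assms by (simp add: w_def)
  have "d / (norm (X - Y) * norm (Z - Y)) = d / sqrt (d\<^sup>2 + w\<^sup>2)"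
    unfolding norm_mult_norm_eq by (simp add: d_def w_def)
  also have "sqrt (d\<^sup>2 + w\<^sup>2) = w * sqrt (1 + (d / w)\<^sup>2)"
  proof -
    have "d\<^sup>2 + w\<^sup>2 = w\<^sup>2 * (1 + (d / w)\<^sup>2)"
      using \<open>w > 0\<close> by (simp add: field_simps)
    then show ?thesis using \<open>w > 0\<close> by (simp add: real_sqrt_mult)
  qed
  also have "d / (w * sqrt (1 + (d / w)\<^sup>2)) = sin (arctan (d / w))"
    by (simp add: sin_arctan)
  also have "\<dots> = cos (pi / 2 - arctan (d / w))"
    by (simp add: cos_diff)
  finally have "plane_angle X Y Z = arccos (cos (pi / 2 - arctan (d / w)))"
    unfolding plane_angle_def d_def by simp
  also have "\<dots> = pi / 2 - arctan (d / w)"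
    using arctan_lbound[of "d / w"] arctan_ubound[of "d / w"] by (intro arccos_cos) linarith+
  finally show ?thesis by (simp add: d_def w_def)
qed

lemma plane_angle_eq_iff:
  assumes "cross2 (X - Y) (Z - Y) \<noteq> 0" "cross2 (X' - Y') (Z' - Y') \<noteq> 0"
  shows "plane_angle X Y Z = plane_angle X' Y' Z' \<longleftrightarrow>
    (X - Y) \<bullet> (Z - Y) * \<bar>cross2 (X' - Y') (Z' - Y')\<bar>
      = (X' - Y') \<bullet> (Z' - Y') * \<bar>cross2 (X - Y) (Z - Y)\<bar>"
  using assms by (auto simp: plane_angle_eq_arctan arctan_eq_iff frac_eq_eq)

section \<open>Barycentric coordinates of the Brocard points\<close>

text \<open>Put \<open>p = BC\<^sup>2\<close>, \<open>q = CA\<^sup>2\<close>, \<open>r = AB\<^sup>2\<close>, and let \<open>SA\<close>, \<open>SB\<close>, \<open>SC\<close> be the dot products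
  of the sides at the vertices, so that \<open>p = SB + SC\<close> and cyclically. If \<open>K / \<bar>S\<bar>\<close> is the
  common cotangent, \<open>\<bar>S\<bar>\<close> being twice the area, the angle conditions read
  \<open>\<beta> r = \<gamma> (K - SA)\<close>, \<open>\<gamma> p = \<alpha> (K - SB)\<close> and \<open>\<alpha> q = \<beta> (K - SC)\<close>. Multiplying them
  eliminates the weights and leaves \<open>(K - SA) (K - SB) (K - SC) = p q r\<close> with positive factors on
  the left. The left side increases with \<open>K\<close>, so \<open>K = SA + SB + SC\<close> is the only solution, and with
  it the three equations become the ratios claimed. In the usual notation this is
  \<open>cot \<omega> = cot A + cot B + cot C\<close> for the Brocard angle \<open>\<omega>\<close>.\<close>

lemma brocard_angles_iff_ratios:
  fixes A B C :: "real^2"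
  assumes ncol: "\<not> collinear {A, B, C}"
    and pos: "\<alpha> > 0" "\<beta> > 0" "\<gamma> > 0" and sum1: "\<alpha> + \<beta> + \<gamma> = 1"
  defines "\<Omega> \<equiv> \<alpha> *\<^sub>R A + \<beta> *\<^sub>R B + \<gamma> *\<^sub>R C"
  shows "plane_angle \<Omega> A B = plane_angle \<Omega> B C \<and> plane_angle \<Omega> B C = plane_angle \<Omega> C A
    \<longleftrightarrow> \<alpha> * (dist C A)\<^sup>2 = \<beta> * (dist A B)\<^sup>2 \<and> \<beta> * (dist A B)\<^sup>2 = \<gamma> * (dist B C)\<^sup>2"
    (is "?angles \<longleftrightarrow> ?ratios")
proof -
  define S where "S = cross2 (A - B) (C - B)"
  have S: "S \<noteq> 0" using ncol by (simp add: S_def collinear_iff_cross2)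
  define p q r where "p = (dist B C)\<^sup>2" and "q = (dist C A)\<^sup>2" and "r = (dist A B)\<^sup>2"
  note pqr = p_def q_def r_def
  have distinct: "A \<noteq> B" "B \<noteq> C" "C \<noteq> A"
    using ncol by (auto simp: insert_commute)
  then have pqr_pos: "p > 0" "q > 0" "r > 0" by (auto simp: pqr)
  define SA SB SC where "SA = (q + r - p) / 2" and "SB = (r + p - q) / 2" and "SC = (p + q - r) / 2"
  have \<alpha>: "\<alpha> = 1 - \<beta> - \<gamma>" using sum1 by simp
  note coords = \<Omega>_def dist_norm power2_norm_eq_inner inner_vec_def sum_2 S_def
      cross2_def pqr \<alpha> SA_def SB_def SC_def
  have cr: "cross2 (\<Omega> - A) (B - A) = \<gamma> * S" "cross2 (\<Omega> - B) (C - B) = \<alpha> * S"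
    "cross2 (\<Omega> - C) (A - C) = \<beta> * S"
    unfolding coords by (simp_all add: algebra_simps)
  have dt: "(\<Omega> - A) \<bullet> (B - A) = \<beta> * r + \<gamma> * SA" "(\<Omega> - B) \<bullet> (C - B) = \<gamma> * p + \<alpha> * SB"
    "(\<Omega> - C) \<bullet> (A - C) = \<alpha> * q + \<beta> * SC"
    unfolding coords by (simp_all add: field_simps)
  have "?angles \<longleftrightarrow> (\<beta> * r + \<gamma> * SA) * (\<alpha> * \<bar>S\<bar>) = (\<gamma> * p + \<alpha> * SB) * (\<gamma> * \<bar>S\<bar>) \<and>
      (\<gamma> * p + \<alpha> * SB) * (\<beta> * \<bar>S\<bar>) = (\<alpha> * q + \<beta> * SC) * (\<alpha> * \<bar>S\<bar>)"
    using S pos by (simp add: plane_angle_eq_iff cr dt abs_mult)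
  also have "\<dots> \<longleftrightarrow> (\<beta> * r + \<gamma> * SA) * \<alpha> = (\<gamma> * p + \<alpha> * SB) * \<gamma> \<and>
      (\<gamma> * p + \<alpha> * SB) * \<beta> = (\<alpha> * q + \<beta> * SC) * \<alpha>"
    using S by (simp flip: mult.assoc)
  also have "\<dots> \<longleftrightarrow> \<alpha> * q = \<beta> * r \<and> \<beta> * r = \<gamma> * p"
  proof
    assume eqs: "(\<beta> * r + \<gamma> * SA) * \<alpha> = (\<gamma> * p + \<alpha> * SB) * \<gamma> \<and>
      (\<gamma> * p + \<alpha> * SB) * \<beta> = (\<alpha> * q + \<beta> * SC) * \<alpha>"
    \<comment> \<open>\<open>K / \<bar>S\<bar>\<close> is the cotangent of the common angle.\<close>
    define K where "K = (\<beta> * r + \<gamma> * SA) / \<gamma>"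
    have 1: "\<beta> * r = \<gamma> * (K - SA)"
      using pos by (simp add: K_def field_simps)
    have "K = (\<gamma> * p + \<alpha> * SB) / \<alpha>"
      using pos eqs by (simp add: K_def field_simps)
    then have 2: "\<gamma> * p = \<alpha> * (K - SB)" using pos by (simp add: field_simps)
    have "K = (\<alpha> * q + \<beta> * SC) / \<beta>"
      unfolding \<open>K = (\<gamma> * p + \<alpha> * SB) / \<alpha>\<close>
      using pos eqs by (simp add: frac_eq_eq)
    then have 3: "\<alpha> * q = \<beta> * (K - SC)" using pos by (simp add: field_simps)
    have gt: "K - SA > 0" "K - SB > 0" "K - SC > 0"
      using 1 2 3 pos pqr_pos by (metis mult_pos_pos zero_less_mult_pos)+
    have "(\<alpha> * \<beta> * \<gamma>) * ((K - SA) * (K - SB) * (K - SC)) = (\<beta> * r) * (\<gamma> * p) * (\<alpha> * q)"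
      unfolding 1 2 3 by (simp add: ac_simps)
    then have prod: "(K - SA) * (K - SB) * (K - SC) = p * q * r"
      using pos by (simp add: ac_simps)
    have "K = SA + SB + SC"
    proof (rule ccontr)
      assume "K \<noteq> SA + SB + SC"
      then consider "K - SA < p \<and> K - SB < q \<and> K - SC < r"
        | "p < K - SA \<and> q < K - SB \<and> r < K - SC"
        unfolding SA_def SB_def SC_def by argo
      then show False
      proof cases
        case 1
        then have "(K - SA) * (K - SB) * (K - SC) < p * q * r"
          using gt pqr_pos by (intro mult_strict_mono) auto
        then show False using prod by simp
      next
        case 2
        then have "p * q * r < (K - SA) * (K - SB) * (K - SC)"
          using gt pqr_pos by (intro mult_strict_mono) auto
        then show False using prod by simp
      qed
    qed
    then have "K - SA = p" "K - SB = q"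
      by (simp_all add: SA_def SB_def SC_def field_simps)
    then show "\<alpha> * q = \<beta> * r \<and> \<beta> * r = \<gamma> * p" using 1 2 by simp
  next
    assume ratios: "\<alpha> * q = \<beta> * r \<and> \<beta> * r = \<gamma> * p"
    have 1: "\<beta> * r + \<gamma> * SA = \<gamma> * ((p + q + r) / 2)"
      "\<gamma> * p + \<alpha> * SB = \<alpha> * ((p + q + r) / 2)"
      "\<alpha> * q + \<beta> * SC = \<beta> * ((p + q + r) / 2)"
      using ratios by (simp_all add: SA_def SB_def SC_def field_simps)
    show "(\<beta> * r + \<gamma> * SA) * \<alpha> = (\<gamma> * p + \<alpha> * SB) * \<gamma> \<and>
      (\<gamma> * p + \<alpha> * SB) * \<beta> = (\<alpha> * q + \<beta> * SC) * \<alpha>"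
      unfolding 1 by (simp add: mult_ac)
  qed
  finally show ?thesis unfolding pqr .
qed

text \<open>The barycentric coordinates \<open>1 / q : 1 / r : 1 / p\<close> of the first Brocard point,
  cleared of denominators. They are positive, so the point is interior; an interior point has
  positive weights, which the ratios then determine up to the normalisation of their sum.\<close>

lemma brocard_point1_barycentric:
  fixes A B C :: "real^2"
  assumes ncol: "\<not> collinear {A, B, C}"
  defines "p \<equiv> (dist B C)\<^sup>2" and "q \<equiv> (dist C A)\<^sup>2" and "r \<equiv> (dist A B)\<^sup>2"
  shows "brocard_point1 A B C =
    (1 / (r * p + p * q + q * r)) *\<^sub>R ((r * p) *\<^sub>R A + (p * q) *\<^sub>R B + (q * r) *\<^sub>R C)"
proof -
  have "A \<noteq> B" "B \<noteq> C" "C \<noteq> A"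
    using ncol by (auto simp: insert_commute)
  then have pos: "p > 0" "q > 0" "r > 0" by (auto simp: p_def q_def r_def)
  define N where "N = r * p + p * q + q * r"
  have N: "N > 0" using pos by (simp add: N_def add_pos_pos)
  define \<Omega> where "\<Omega> = (r * p / N) *\<^sub>R A + (p * q / N) *\<^sub>R B + (q * r / N) *\<^sub>R C"
  have interior: "interior (convex hull {A, B, C}) =
      {v. \<exists>x y z. 0 < x \<and> 0 < y \<and> 0 < z \<and> x + y + z = 1 \<and> x *\<^sub>R A + y *\<^sub>R B + z *\<^sub>R C = v}"
    by (rule interior_convex_hull_3_minimal[OF ncol]) simp
  have sum1: "r * p / N + p * q / N + q * r / N = 1"
    using N by (simp add: N_def flip: add_divide_distrib)
  have "brocard_point1 A B C = \<Omega>"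
    unfolding brocard_point1_def
  proof (rule the_equality)
    show "\<Omega> \<in> interior (convex hull {A, B, C}) \<and>
      plane_angle \<Omega> A B = plane_angle \<Omega> B C \<and> plane_angle \<Omega> B C = plane_angle \<Omega> C A"
    proof
      show "\<Omega> \<in> interior (convex hull {A, B, C})"
        unfolding interior
      proof (intro CollectI exI conjI)
        show "(r * p / N) *\<^sub>R A + (p * q / N) *\<^sub>R B + (q * r / N) *\<^sub>R C = \<Omega>"
          by (simp add: \<Omega>_def)
      qed (use pos N sum1 in auto)
      show "plane_angle \<Omega> A B = plane_angle \<Omega> B C \<and> plane_angle \<Omega> B C = plane_angle \<Omega> C A"
        unfolding \<Omega>_def using pos N
        by (subst brocard_angles_iff_ratios[OF ncol _ _ _ sum1])
           (auto simp flip: p_def q_def r_def)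
    qed
  next
    fix X
    assume X: "X \<in> interior (convex hull {A, B, C}) \<and>
      plane_angle X A B = plane_angle X B C \<and> plane_angle X B C = plane_angle X C A"
    then obtain x y z where xyz: "0 < x" "0 < y" "0 < z" "x + y + z = 1"
      and X_eq: "X = x *\<^sub>R A + y *\<^sub>R B + z *\<^sub>R C"
      unfolding interior by blast
    have rat: "x * q = y * r" "y * r = z * p"
      using X brocard_angles_iff_ratios[OF ncol xyz] unfolding X_eq p_def q_def r_def by auto
    define k where "k = x * q"
    have eqs: "x = k / q" "y = k / r" "z = k / p"
      using rat pos by (auto simp: k_def field_simps)
    have "k * N = p * q * r"
      using xyz(4) pos unfolding eqs N_def by (simp add: field_simps)
    then have "k = p * q * r / N" using N by (simp add: field_simps)
    then have "x = r * p / N" "y = p * q / N" "z = q * r / N"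
      using pos unfolding eqs by (simp_all add: field_simps)
    then show "X = \<Omega>" by (simp add: X_eq \<Omega>_def)
  qed
  then show ?thesis by (simp add: \<Omega>_def N_def scaleR_add_right)
qed

lemma brocard_point2_swap: "brocard_point2 A B C = brocard_point1 B A C"
  unfolding brocard_point1_def brocard_point2_def insert_commute[of A B] by metis

section \<open>Brocard points of the right triangles on a diameter\<close>

text \<open>The Brocard points for the third vertex \<open>a (c, s)\<close> on the circle; \<open>\<epsilon> = 1\<close> gives the first
  point and \<open>\<epsilon> = - 1\<close> the second. The point on the circle is given by \<open>c\<close> and \<open>s\<close> rather than
  by an angle because every assertion about images and injectivity is algebraic in them.\<close>

definition brocard_xy :: "real \<Rightarrow> real \<Rightarrow> real \<Rightarrow> real \<Rightarrow> real^2" where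
  "brocard_xy \<epsilon> a c s =
     vector [a * (4 * c - \<epsilon> * s\<^sup>2) / (4 + s\<^sup>2), a * (2 * (1 + \<epsilon> * c) * s) / (4 + s\<^sup>2)]"

lemma vec2_eq_iff: "(v :: real^2) = w \<longleftrightarrow> v$1 = w$1 \<and> v$2 = w$2"
  by (auto simp: vec_eq_iff forall_2)

lemma four_plus_square: "4 + (s::real)\<^sup>2 > 0" "4 + (s::real)\<^sup>2 \<noteq> 0"
  using zero_le_power2[of s] by linarith+

lemma collinear_thales_iff:
  assumes "a > 0"
  shows "collinear {vector [- a, 0], vector [a, 0], vector [a * c, a * s] :: real^2} \<longleftrightarrow> s = 0"
  using assms by (auto simp: collinear_iff_cross2 cross2_def)

text \<open>By Thales the angle at \<open>C\<close> is right, and the squared sides are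
  \<open>AB\<^sup>2 = 4 a\<^sup>2\<close>, \<open>BC\<^sup>2 = 2 a\<^sup>2 (1 - c)\<close>, \<open>CA\<^sup>2 = 2 a\<^sup>2 (1 + c)\<close>. Substituting them in the
  barycentric formula gives the denominator \<open>5 - c\<^sup>2 = 4 + s\<^sup>2\<close>.\<close>

lemma brocard_thales:
  fixes a c s :: real
  assumes a: "a > 0" and cs: "c\<^sup>2 + s\<^sup>2 = 1" and s: "s \<noteq> 0"
  defines "A \<equiv> vector [- a, 0] :: real^2" and "B \<equiv> vector [a, 0]" and "C \<equiv> vector [a * c, a * s]"
  shows "brocard_point1 A B C = brocard_xy 1 a c s"
    and "brocard_point2 A B C = brocard_xy (- 1) a c s"
proof -
  have s2: "s\<^sup>2 = 1 - c\<^sup>2" using cs by simp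
  have d: "4 + s\<^sup>2 > 0" "5 - c\<^sup>2 \<noteq> 0" "a ^ 4 \<noteq> 0" using four_plus_square[of s] s2 a by auto
  have ncol: "\<not> collinear {A, B, C}"
    unfolding A_def B_def C_def using collinear_thales_iff a s by blast
  have AB: "(dist A B)\<^sup>2 = 4 * a\<^sup>2"
    by (simp add: A_def B_def dist_norm power2_norm_eq_inner inner_vec_def sum_2)
       (simp add: power2_eq_square)
  have BC: "(dist B C)\<^sup>2 = 2 * a\<^sup>2 * (1 - c)"
  proof -
    have "(dist B C)\<^sup>2 = a\<^sup>2 * (1 - 2 * c + (c\<^sup>2 + s\<^sup>2))"
      by (simp add: B_def C_def dist_norm power2_norm_eq_inner inner_vec_def sum_2)
         (simp add: power2_eq_square algebra_simps)
    then show ?thesis by (simp add: cs)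
  qed
  have CA: "(dist C A)\<^sup>2 = 2 * a\<^sup>2 * (1 + c)"
  proof -
    have "(dist C A)\<^sup>2 = a\<^sup>2 * (1 + 2 * c + (c\<^sup>2 + s\<^sup>2))"
      by (simp add: A_def C_def dist_norm power2_norm_eq_inner inner_vec_def sum_2)
         (simp add: power2_eq_square algebra_simps)
    then show ?thesis by (simp add: cs)
  qed
  have N: "4 * a\<^sup>2 * (2 * a\<^sup>2 * (1 - c)) + 2 * a\<^sup>2 * (1 - c) * (2 * a\<^sup>2 * (1 + c))
      + 2 * a\<^sup>2 * (1 + c) * (4 * a\<^sup>2) = 4 * a ^ 4 * (5 - c\<^sup>2)"
    by (simp add: algebra_simps power2_eq_square power4_eq_xxxx)
  have N': "4 * a\<^sup>2 * (2 * a\<^sup>2 * (1 + c)) + 2 * a\<^sup>2 * (1 + c) * (2 * a\<^sup>2 * (1 - c))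
      + 2 * a\<^sup>2 * (1 - c) * (4 * a\<^sup>2) = 4 * a ^ 4 * (5 - c\<^sup>2)"
    by (simp add: algebra_simps power2_eq_square power4_eq_xxxx)
  show "brocard_point1 A B C = brocard_xy 1 a c s"
    unfolding brocard_point1_barycentric[OF ncol] AB BC CA N brocard_xy_def vec2_eq_iff
    using d(2,3) a
    by (simp add: A_def B_def C_def s2 divide_simps)
       (simp add: algebra_simps power2_eq_square power4_eq_xxxx)
  have ncol': "\<not> collinear {B, A, C}" using ncol by (simp add: insert_commute)
  show "brocard_point2 A B C = brocard_xy (- 1) a c s"
    unfolding brocard_point2_swap brocard_point1_barycentric[OF ncol']
      dist_commute[of B A] dist_commute[of A C] dist_commute[of C B]
      AB BC CA N' brocard_xy_def vec2_eq_iff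
    using d(2,3) a
    by (simp add: A_def B_def C_def s2 divide_simps)
       (simp add: algebra_simps power2_eq_square power4_eq_xxxx)
qed

lemma eventually_sin_neq_0: "\<forall>\<^sub>F s in at t. sin s \<noteq> (0::real)"
proof (cases "sin t = 0")
  case False
  have "(sin \<longlongrightarrow> sin t) (at t)" by (intro tendsto_intros)
  then show ?thesis using False tendsto_imp_eventually_ne by blast
next
  case True
  then have "cos t \<noteq> 0" by (metis sin_cos_squared_add zero_neq_one add_0 power_zero_numeral)
  have "sin s \<noteq> 0" if "s \<noteq> t" "dist s t < 1" for s
  proof -
    have "sin s = sin (s - t) * cos t" 
      using True by (simp add: sin_diff) (metis True sin_cos_squared_add2 add_0_right mult.assoc mult.right_neutral power2_eq_square power_zero_numeral)
    moreover have "sin (s - t) \<noteq> 0"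
      using that pi_gt3 sin_eq_0_pi[of "s - t"] by (auto simp: dist_real_def abs_if split: if_splits)
    ultimately show ?thesis using \<open>cos t \<noteq> 0\<close> by simp
  qed
  then show ?thesis unfolding eventually_at by (intro exI[of _ 1]) auto
qed

section \<open>The two curves and their velocity\<close>

definition brocard_curve :: "real \<Rightarrow> real \<Rightarrow> real \<Rightarrow> real^2" where
  "brocard_curve \<epsilon> a t = brocard_xy \<epsilon> a (cos t) (sin t)"

lemma brocard_curve_nth:
  "brocard_curve \<epsilon> a t $ 1 = a * (4 * cos t - \<epsilon> * (sin t)\<^sup>2) / (4 + (sin t)\<^sup>2)"
  "brocard_curve \<epsilon> a t $ 2 = a * (2 * (1 + \<epsilon> * cos t) * sin t) / (4 + (sin t)\<^sup>2)"
  by (simp_all add: brocard_curve_def brocard_xy_def)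

lemma has_vector_derivative_vec2:
  fixes f :: "real \<Rightarrow> real^2"
  assumes "((\<lambda>t. f t $ 1) has_real_derivative v $ 1) (at t)"
    and "((\<lambda>t. f t $ 2) has_real_derivative v $ 2) (at t)"
  shows "(f has_vector_derivative v) (at t)"
proof -
  have eq: "(w $ 1) *\<^sub>R axis 1 1 + (w $ 2) *\<^sub>R axis 2 1 = w" for w :: "real^2"
    by (simp add: vec2_eq_iff axis_def)
  have "((\<lambda>t. (f t $ 1) *\<^sub>R axis 1 1 + (f t $ 2) *\<^sub>R axis 2 1 :: real^2)
      has_vector_derivative (v $ 1) *\<^sub>R axis 1 1 + (v $ 2) *\<^sub>R axis 2 1) (at t)"
    using assms by (auto intro!: derivative_eq_intros
      simp: has_real_derivative_iff_has_vector_derivative)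
  then show ?thesis unfolding eq .
qed

text \<open>The second coordinate is factored so that it visibly vanishes at the cusp \<open>\<epsilon> cos t = - 1\<close>.\<close>

definition brocard_velocity :: "real \<Rightarrow> real \<Rightarrow> real \<Rightarrow> real^2" where
  "brocard_velocity \<epsilon> a t = (a / (4 + (sin t)\<^sup>2)\<^sup>2) *\<^sub>R
     vector [- 4 * sin t * (5 + 2 * \<epsilon> * cos t + (cos t)\<^sup>2),
       2 * \<epsilon> * (1 + \<epsilon> * cos t) * ((cos t)\<^sup>2 + 8 * \<epsilon> * cos t - 5)]"

lemma brocard_curve_has_vector_derivative:
  assumes "\<epsilon>\<^sup>2 = 1"
  shows "(brocard_curve \<epsilon> a has_vector_derivative brocard_velocity \<epsilon> a t) (at t)"
proof (rule has_vector_derivative_vec2)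
  define c s where "c = cos t" and "s = sin t"
  have s2: "s\<^sup>2 = 1 - c\<^sup>2" by (simp add: c_def s_def sin_squared_eq)
  note d = four_plus_square[of "sin t"]
  have "((\<lambda>t. brocard_curve \<epsilon> a t $ 1) has_real_derivative
      a * ((- 4 * s - 2 * \<epsilon> * s * c) * (4 + s\<^sup>2) - (4 * c - \<epsilon> * s\<^sup>2) * (2 * s * c)) / (4 + s\<^sup>2)\<^sup>2) (at t)"
    unfolding brocard_curve_nth c_def s_def using d(2)
    by (auto intro!: derivative_eq_intros simp: divide_simps) (simp add: algebra_simps power2_eq_square)
  also have "(- 4 * s - 2 * \<epsilon> * s * c) * (4 + s\<^sup>2) - (4 * c - \<epsilon> * s\<^sup>2) * (2 * s * c)
      = - 4 * s * (5 + 2 * \<epsilon> * c + c\<^sup>2)"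
    unfolding s2 by (simp add: algebra_simps power2_eq_square)
  also have "a * \<dots> / (4 + s\<^sup>2)\<^sup>2 = brocard_velocity \<epsilon> a t $ 1"
    by (simp add: brocard_velocity_def c_def s_def)
  finally show "((\<lambda>t. brocard_curve \<epsilon> a t $ 1) has_real_derivative brocard_velocity \<epsilon> a t $ 1) (at t)" .
  have "((\<lambda>t. brocard_curve \<epsilon> a t $ 2) has_real_derivative
      a * (2 * (c + \<epsilon> * (c\<^sup>2 - s\<^sup>2)) * (4 + s\<^sup>2) - 2 * (1 + \<epsilon> * c) * (2 * s\<^sup>2 * c)) / (4 + s\<^sup>2)\<^sup>2) (at t)"
    unfolding brocard_curve_nth c_def s_def using d(2)
    by (auto intro!: derivative_eq_intros simp: divide_simps) (simp add: algebra_simps power2_eq_square)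
  also have "2 * (c + \<epsilon> * (c\<^sup>2 - s\<^sup>2)) * (4 + s\<^sup>2) - 2 * (1 + \<epsilon> * c) * (2 * s\<^sup>2 * c)
      = 6 * c + 2 * c ^ 3 + \<epsilon> * (18 * c\<^sup>2 - 10)"
    unfolding s2 by (simp add: algebra_simps power2_eq_square power3_eq_cube)
  also have "\<dots> = 2 * \<epsilon> * (1 + \<epsilon> * c) * (c\<^sup>2 + 8 * \<epsilon> * c - 5)"
  proof -
    have "2 * \<epsilon> * (1 + \<epsilon> * c) * (c\<^sup>2 + 8 * \<epsilon> * c - 5)
        = \<epsilon> * (2 * c\<^sup>2 - 10) + \<epsilon>\<^sup>2 * (16 * c + 2 * c ^ 3 - 10 * c) + \<epsilon> * \<epsilon>\<^sup>2 * (16 * c\<^sup>2)"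
      by (simp add: algebra_simps power2_eq_square power3_eq_cube)
    then show ?thesis unfolding assms by (simp add: algebra_simps)
  qed
  also have "a * \<dots> / (4 + s\<^sup>2)\<^sup>2 = brocard_velocity \<epsilon> a t $ 2"
    by (simp add: brocard_velocity_def c_def s_def)
  finally show "((\<lambda>t. brocard_curve \<epsilon> a t $ 2) has_real_derivative brocard_velocity \<epsilon> a t $ 2) (at t)" .
qed

lemma continuous_on_brocard_curve:
  assumes "\<epsilon>\<^sup>2 = 1"
  shows "continuous_on S (brocard_curve \<epsilon> a)"
  using brocard_curve_has_vector_derivative[OF assms]
  by (meson continuous_at_imp_continuous_on has_vector_derivative_continuous)

text \<open>The rational formula is continuous across the degenerate triangles \<open>sin t = 0\<close>, which
  are isolated, so it also gives the limits that define the Brocard points there.\<close>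

lemma point_curve_eq_brocard_curve:
  assumes a: "a > 0" and \<epsilon>: "\<epsilon>\<^sup>2 = 1"
    and F: "\<And>c s. c\<^sup>2 + s\<^sup>2 = 1 \<Longrightarrow> s \<noteq> 0 \<Longrightarrow>
      F (vector [- a, 0]) (vector [a, 0]) (vector [a * c, a * s]) = brocard_xy \<epsilon> a c s"
  shows "point_curve F (vector [- a, 0]) (vector [a, 0]) (\<lambda>t. vector [a * cos t, a * sin t])
    = brocard_curve \<epsilon> a" (is "?\<Gamma> = _")
proof
  fix t
  let ?G = "\<lambda>t. F (vector [- a, 0]) (vector [a, 0]) (vector [a * cos t, a * sin t])"
  have G: "?G s = brocard_curve \<epsilon> a s" if "sin s \<noteq> 0" for s
    using that by (simp add: F brocard_curve_def)
  have "(brocard_curve \<epsilon> a \<longlongrightarrow> brocard_curve \<epsilon> a t) (at t)"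
    using continuous_on_brocard_curve[OF \<epsilon>, of UNIV a] by (simp add: continuous_on_def)
  moreover have "\<forall>\<^sub>F s in at t. brocard_curve \<epsilon> a s = ?G s"
    using eventually_sin_neq_0[of t] by eventually_elim (simp add: G)
  ultimately have "(?G \<longlongrightarrow> brocard_curve \<epsilon> a t) (at t)"
    by (rule Lim_transform_eventually)
  then have "Lim (at t) ?G = brocard_curve \<epsilon> a t"
    by (intro tendsto_Lim) auto
  then show "?\<Gamma> t = brocard_curve \<epsilon> a t"
    by (auto simp: point_curve_def collinear_thales_iff[OF a] G)
qed

section \<open>The enclosed area\<close>

text \<open>After cancelling one factor \<open>4 + sin\<^sup>2 t\<close> the integrand splits into a part that is even
  in \<open>cos t\<close> and one that is odd in it. The even part carries the area.\<close>

lemma brocard_area_integrand: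
  assumes "\<epsilon>\<^sup>2 = 1"
  shows "brocard_curve \<epsilon> a t $ 1 * brocard_velocity \<epsilon> a t $ 2
      - brocard_curve \<epsilon> a t $ 2 * brocard_velocity \<epsilon> a t $ 1
    = a\<^sup>2 * (2 / (4 + (sin t)\<^sup>2) + \<epsilon> * (cos t * (8 - 6 * (sin t)\<^sup>2) / (4 + (sin t)\<^sup>2)\<^sup>2))"
proof -
  define c s D where "c = cos t" and "s = sin t" and "D = 4 + s\<^sup>2"
  have c2: "c\<^sup>2 = 5 - D" and s2: "s\<^sup>2 = D - 4" by (simp_all add: c_def s_def D_def cos_squared_eq)
  have D: "D \<noteq> 0" unfolding D_def by (rule four_plus_square)
  have \<epsilon>: "\<epsilon> = 1 \<or> \<epsilon> = - 1" using assms by (simp add: power2_eq_1_iff)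
  have *: "(4 * c - \<epsilon> * s\<^sup>2) * (2 * \<epsilon> * (1 + \<epsilon> * c) * (c\<^sup>2 + 8 * \<epsilon> * c - 5))
      - (2 * (1 + \<epsilon> * c) * s) * (- 4 * s * (5 + 2 * \<epsilon> * c + c\<^sup>2))
      = D * (2 * D + \<epsilon> * (c * (8 - 6 * s\<^sup>2)))"
  proof -
    have "(4 * c - \<epsilon> * s\<^sup>2) * (2 * \<epsilon> * (1 + \<epsilon> * c) * (c\<^sup>2 + 8 * \<epsilon> * c - 5))
      - (2 * (1 + \<epsilon> * c) * s) * (- 4 * s * (5 + 2 * \<epsilon> * c + c\<^sup>2))
      = (4 * c - \<epsilon> * s\<^sup>2) * (2 * \<epsilon> * (c\<^sup>2 + 8 * \<epsilon> * c - 5 + \<epsilon> * c * c\<^sup>2 + 8 * \<epsilon>\<^sup>2 * c\<^sup>2 - 5 * \<epsilon> * c))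
      + 8 * s\<^sup>2 * (5 + 2 * \<epsilon> * c + c\<^sup>2 + 5 * \<epsilon> * c + 2 * \<epsilon>\<^sup>2 * c\<^sup>2 + \<epsilon> * c * c\<^sup>2)"
      by (simp add: algebra_simps power2_eq_square)
    also have "\<dots> = D * (2 * D + \<epsilon> * (c * (8 - 6 * s\<^sup>2)))"
    proof -
      have cc: "c * (c * x) = (5 - D) * x" for x
        using c2 by (simp add: power2_eq_square flip: mult.assoc)
      show ?thesis unfolding c2 s2 using \<epsilon>
        by (auto simp: algebra_simps cc power2_eq_square)
    qed
    finally show ?thesis .
  qed
  have "brocard_curve \<epsilon> a t $ 1 * brocard_velocity \<epsilon> a t $ 2
      - brocard_curve \<epsilon> a t $ 2 * brocard_velocity \<epsilon> a t $ 1
    = a\<^sup>2 * (((4 * c - \<epsilon> * s\<^sup>2) * (2 * \<epsilon> * (1 + \<epsilon> * c) * (c\<^sup>2 + 8 * \<epsilon> * c - 5))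
      - (2 * (1 + \<epsilon> * c) * s) * (- 4 * s * (5 + 2 * \<epsilon> * c + c\<^sup>2))) / (D * D\<^sup>2))"
  proof -
    have scale: "a * N / D * (a / D\<^sup>2 * W) - a * M / D * (a / D\<^sup>2 * V)
        = a\<^sup>2 * ((N * W - M * V) / (D * D\<^sup>2))" for N M V W
      by (simp add: diff_divide_distrib right_diff_distrib power2_eq_square mult_ac)
    show ?thesis
      unfolding scale[symmetric] by (simp add: brocard_curve_nth brocard_velocity_def c_def s_def D_def)
  qed
  also have "\<dots> = a\<^sup>2 * (2 / D + \<epsilon> * (c * (8 - 6 * s\<^sup>2) / D\<^sup>2))"
    unfolding * using D by (simp add: field_simps power2_eq_square)
  finally show ?thesis unfolding c_def s_def D_def .
qed

text \<open>With \<open>k = sqrt 5 / 2\<close> an antiderivative is \<open>arctan (k tan t) / sqrt 5\<close>, which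
  jumps where \<open>cos t = 0\<close>. Here \<open>arctan (k tan t)\<close> is the argument of the vector
  \<open>(cos t, k sin t)\<close>. Rotating this vector by \<open>- t\<close> yields \<open>(q t, p t)\<close> with \<open>q t > 0\<close>, so that
  \<open>t + arctan (p t / q t)\<close> is a smooth choice of the argument on the whole line.\<close>

lemma integral_inverse_4_plus_sin_squared:
  "((\<lambda>t. 2 / (4 + (sin t)\<^sup>2)) has_integral 2 * pi / sqrt 5) {0..2*pi}"
proof -
  define k :: real where "k = sqrt 5 / 2"
  have k: "k > 0" "k * k = 5 / 4" by (simp_all add: k_def)
  define p q where "p = (\<lambda>t. (k - 1) * sin t * cos t)" and "q = (\<lambda>t. (cos t)\<^sup>2 + k * (sin t)\<^sup>2)"
  have "((\<lambda>t. (t + arctan (p t / q t)) / sqrt 5) has_real_derivative 2 / (4 + (sin t)\<^sup>2)) (at t)" for t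
  proof -
    define c s where "c = cos t" and "s = sin t"
    have c2: "c\<^sup>2 = 1 - s\<^sup>2" by (simp add: c_def s_def cos_squared_eq)
    have pt: "p t = (k - 1) * s * c" and qt: "q t = c\<^sup>2 + k * s\<^sup>2"
      by (simp_all add: p_def q_def c_def s_def)
    have q: "q t > 0"
    proof -
      have "c \<noteq> 0 \<or> s \<noteq> 0" using c2 by auto
      then have "c\<^sup>2 + k * s\<^sup>2 > 0" using k(1) by (auto intro: add_pos_nonneg add_nonneg_pos)
      then show ?thesis by (simp add: qt)
    qed
    define p' q' where "p' = (k - 1) * (c\<^sup>2 - s\<^sup>2)" and "q' = 2 * (k - 1) * (s * c)"
    have p: "(p has_real_derivative p') (at t)"
      unfolding p_def p'_def c_def s_def
      by (auto intro!: derivative_eq_intros simp: algebra_simps power2_eq_square)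
    have qd: "(q has_real_derivative q') (at t)"
      unfolding q_def q'_def c_def s_def
      by (auto intro!: derivative_eq_intros simp: algebra_simps power2_eq_square)
    have sumsq: "(p t)\<^sup>2 + (q t)\<^sup>2 = (4 + s\<^sup>2) / 4"
    proof -
      have "(p t)\<^sup>2 + (q t)\<^sup>2 = (c\<^sup>2 + s\<^sup>2) * (c\<^sup>2 + (k * k) * s\<^sup>2)"
        unfolding pt qt by (simp add: algebra_simps power2_eq_square)
      then show ?thesis by (simp add: c2 k(2) field_simps)
    qed
    \<comment> \<open>The numerator of the derivative of \<open>arctan (p t / q t)\<close>.\<close>
    have wronskian: "p' * q t - p t * q' = k - (4 + s\<^sup>2) / 4"
    proof -
      have "p' * q t - p t * q' = (c\<^sup>2 + s\<^sup>2) * (k * (c\<^sup>2 + s\<^sup>2) - (c\<^sup>2 + (k * k) * s\<^sup>2))"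
        unfolding pt qt p'_def q'_def by (simp add: algebra_simps power2_eq_square)
      then show ?thesis by (simp add: c2 k(2) field_simps)
    qed
    have "((\<lambda>t. (t + arctan (p t / q t)) / sqrt 5) has_real_derivative
        (1 + (p' * q t - p t * q') / ((p t)\<^sup>2 + (q t)\<^sup>2)) / sqrt 5) (at t)"
      using q by (auto intro!: derivative_eq_intros p qd simp: divide_simps)
        (auto simp: algebra_simps power2_eq_square)
    also have "(1 + (p' * q t - p t * q') / ((p t)\<^sup>2 + (q t)\<^sup>2)) / sqrt 5 = 2 / (4 + s\<^sup>2)"
    proof -
      have "1 + (k - (4 + s\<^sup>2) / 4) / ((4 + s\<^sup>2) / 4) = 4 * k / (4 + s\<^sup>2)"
        using four_plus_square(2)[of s] by (simp add: field_simps)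
      then show ?thesis unfolding sumsq wronskian by (simp add: k_def)
    qed
    finally show ?thesis by (simp add: s_def)
  qed
  then have "((\<lambda>t. 2 / (4 + (sin t)\<^sup>2)) has_integral
      (2 * pi + arctan (p (2 * pi) / q (2 * pi))) / sqrt 5 - (0 + arctan (p 0 / q 0)) / sqrt 5) {0..2*pi}"
    by (intro fundamental_theorem_of_calculus)
       (auto simp flip: has_real_derivative_iff_has_vector_derivative intro: DERIV_subset)
  then show ?thesis by (simp add: p_def)
qed

text \<open>The integrand is \<open>cos t\<close> times a function of \<open>sin t\<close>, so it has a periodic
  antiderivative.\<close>

lemma integral_odd_part:
  "((\<lambda>t. cos t * (8 - 6 * (sin t)\<^sup>2) / (4 + (sin t)\<^sup>2)\<^sup>2) has_integral 0) {0..2*pi}"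
proof -
  have "((\<lambda>t. 4 * sin t / (4 + (sin t)\<^sup>2) - arctan (sin t / 2)) has_real_derivative
      cos t * (8 - 6 * (sin t)\<^sup>2) / (4 + (sin t)\<^sup>2)\<^sup>2) (at t)" for t
  proof -
    define s c where "s = sin t" and "c = cos t"
    note D = four_plus_square(2)[of s]
    have inv: "inverse (1 + (s / 2)\<^sup>2) = 4 / (4 + s\<^sup>2)"
    proof -
      have "1 + (s / 2)\<^sup>2 = (4 + s\<^sup>2) / 4" by (simp add: field_simps)
      then show ?thesis by (metis inverse_divide)
    qed
    have "((\<lambda>t. 4 * sin t / (4 + (sin t)\<^sup>2) - arctan (sin t / 2)) has_real_derivative
        ((4 * c) * (4 + s\<^sup>2) - 4 * s * (2 * s * c)) / (4 + s\<^sup>2)\<^sup>2 - inverse (1 + (s / 2)\<^sup>2) * (c / 2)) (at t)"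
      unfolding s_def c_def using four_plus_square(2)[of "sin t"]
      by (auto intro!: derivative_eq_intros simp: power2_eq_square)
    also have "((4 * c) * (4 + s\<^sup>2) - 4 * s * (2 * s * c)) / (4 + s\<^sup>2)\<^sup>2 - inverse (1 + (s / 2)\<^sup>2) * (c / 2)
        = c * (8 - 6 * s\<^sup>2) / (4 + s\<^sup>2)\<^sup>2"
      unfolding inv using D by (simp add: divide_simps) (simp add: algebra_simps power2_eq_square)
    finally show ?thesis by (simp add: s_def c_def)
  qed
  then have "((\<lambda>t. cos t * (8 - 6 * (sin t)\<^sup>2) / (4 + (sin t)\<^sup>2)\<^sup>2) has_integral
     (4 * sin (2 * pi) / (4 + (sin (2 * pi))\<^sup>2) - arctan (sin (2 * pi) / 2))
       - (4 * sin 0 / (4 + (sin 0)\<^sup>2) - arctan (sin 0 / 2))) {0..2*pi}"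
    by (intro fundamental_theorem_of_calculus)
       (auto simp flip: has_real_derivative_iff_has_vector_derivative intro: DERIV_subset)
  then show ?thesis by simp
qed

lemma enclosed_area_brocard_curve:
  assumes "\<epsilon>\<^sup>2 = 1"
  shows "enclosed_area (brocard_curve \<epsilon> a) = pi * a\<^sup>2 / sqrt 5"
proof -
  have "((\<lambda>t. a\<^sup>2 * (2 / (4 + (sin t)\<^sup>2) + \<epsilon> * (cos t * (8 - 6 * (sin t)\<^sup>2) / (4 + (sin t)\<^sup>2)\<^sup>2)))
      has_integral a\<^sup>2 * (2 * pi / sqrt 5 + \<epsilon> * 0)) {0..2*pi}"
    by (intro has_integral_mult_right has_integral_add
        integral_inverse_4_plus_sin_squared integral_odd_part)
  from integral_unique[OF this] show ?thesis
    unfolding enclosed_area_def vector_derivative_at[OF brocard_curve_has_vector_derivative[OF assms]]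
      brocard_area_integrand[OF assms]
    by simp
qed

section \<open>Recovering the parameter from the point\<close>

lemma range_brocard_curve:
  "brocard_curve \<epsilon> a ` {0..<2*pi} = {brocard_xy \<epsilon> a c s | c s. c\<^sup>2 + s\<^sup>2 = 1}"
proof (intro equalityI subsetI)
  fix v assume "v \<in> {brocard_xy \<epsilon> a c s | c s. c\<^sup>2 + s\<^sup>2 = 1}"
  then obtain c s where v: "v = brocard_xy \<epsilon> a c s" and "c\<^sup>2 + s\<^sup>2 = 1" by blast
  then obtain t where "0 \<le> t" "t < 2 * pi" "c = cos t" "s = sin t"
    by (rule_tac sincos_total_2pi) auto
  then show "v \<in> brocard_curve \<epsilon> a ` {0..<2*pi}"
    by (auto simp: v brocard_curve_def)
qed (force simp: brocard_curve_def)

text \<open>The chord from the cusp \<open>(- \<epsilon> a, 0)\<close> to the point of parameter \<open>(c, s)\<close> has slope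
  \<open>\<epsilon> s / 2\<close>. This recovers the parameter from the point by rational functions, and both
  injectivity and the quartic come from it.\<close>

lemma brocard_xy_chord:
  assumes "\<epsilon>\<^sup>2 = 1"
  shows "a + \<epsilon> * brocard_xy \<epsilon> a c s $ 1 = a * (4 * (1 + \<epsilon> * c) / (4 + s\<^sup>2))"
    and "2 * brocard_xy \<epsilon> a c s $ 2 = s * (a + \<epsilon> * brocard_xy \<epsilon> a c s $ 1)"
proof -
  show 1: "a + \<epsilon> * brocard_xy \<epsilon> a c s $ 1 = a * (4 * (1 + \<epsilon> * c) / (4 + s\<^sup>2))"
    using assms four_plus_square(2)[of s]
    by (simp add: brocard_xy_def field_simps) (simp add: power2_eq_square flip: mult.assoc)
  show "2 * brocard_xy \<epsilon> a c s $ 2 = s * (a + \<epsilon> * brocard_xy \<epsilon> a c s $ 1)"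
    unfolding 1 by (simp add: brocard_xy_def)
qed

text \<open>The slope of the chord from the cusp determines \<open>s\<close>, and then its horizontal extent
  determines \<open>c\<close>; at the cusp itself \<open>c = - \<epsilon>\<close>.\<close>

lemma brocard_xy_inject:
  assumes a: "a > 0" and \<epsilon>: "\<epsilon>\<^sup>2 = 1" and cs: "c\<^sup>2 + s\<^sup>2 = 1" "c'\<^sup>2 + s'\<^sup>2 = 1"
    and eq: "brocard_xy \<epsilon> a c s = brocard_xy \<epsilon> a c' s'"
  shows "c = c' \<and> s = s'"
proof -
  define u where "u = a + \<epsilon> * brocard_xy \<epsilon> a c s $ 1"
  have \<epsilon>1: "\<epsilon> = 1 \<or> \<epsilon> = - 1" using \<epsilon> by (simp add: power2_eq_1_iff)
  have "u = a * (4 * (1 + \<epsilon> * c) / (4 + s\<^sup>2))"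
    unfolding u_def by (rule brocard_xy_chord(1)[OF \<epsilon>])
  moreover have "u = a * (4 * (1 + \<epsilon> * c') / (4 + s'\<^sup>2))"
    unfolding u_def eq by (rule brocard_xy_chord(1)[OF \<epsilon>])
  ultimately have u: "u = a * (4 * (1 + \<epsilon> * c) / (4 + s\<^sup>2))"
    "u = a * (4 * (1 + \<epsilon> * c') / (4 + s'\<^sup>2))" .
  have su: "s * u = s' * u"
    using brocard_xy_chord(2)[OF \<epsilon>, of a c s] brocard_xy_chord(2)[OF \<epsilon>, of a c' s'] eq
    by (auto simp: u_def)
  show ?thesis
  proof (cases "u = 0")
    case True
    then have "1 + \<epsilon> * c = 0" "1 + \<epsilon> * c' = 0"
      using u a four_plus_square(2) by auto
    then have "c = - \<epsilon>" "c' = - \<epsilon>" using \<epsilon>1 by auto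
    then show ?thesis using cs \<epsilon> by simp
  next
    case False
    then have s: "s = s'" using su by simp
    then have "1 + \<epsilon> * c = 1 + \<epsilon> * c'" using u a four_plus_square(2)[of s'] by (auto simp: field_simps)
    then show ?thesis using s \<epsilon>1 by auto
  qed
qed

lemma cos_sin_eq_imp_eq:
  fixes x y :: real
  assumes "cos x = cos y" "sin x = sin y" "\<bar>x - y\<bar> < 2 * pi"
  shows "x = y"
proof -
  obtain n :: int where n: "x = y + 2 * pi * n"
    using assms(1,2) sin_cos_eq_iff[of x y] by (auto simp: mult_ac)
  then have "2 * pi * \<bar>real_of_int n\<bar> < 2 * pi" using assms(3) by (simp add: abs_mult)
  then have "\<bar>real_of_int n\<bar> < 1" by simp
  then have "n = 0" by linarith
  then show ?thesis using n by simp
qed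

section \<open>Cusps\<close>

text \<open>Since \<open>1 + \<epsilon> cos t = sin\<^sup>2 t / (1 - \<epsilon> cos t)\<close>, the velocity near the cusp is
  \<open>sin t\<close> times a continuous field \<open>w\<close> that does not vanish at \<open>t\<^sub>0\<close>. The unit tangent is therefore
  \<open>sgn (sin t)\<close> times a continuous unit vector, and it flips when \<open>sin\<close> changes sign.\<close>

lemma brocard_curve_cusp_at:
  assumes a: "a > 0" and \<epsilon>: "\<epsilon>\<^sup>2 = 1" and t0: "cos t\<^sub>0 = - \<epsilon>"
  shows "cusp_at (brocard_curve \<epsilon> a) t\<^sub>0"
proof -
  note deriv = brocard_curve_has_vector_derivative[OF \<epsilon>, of a]
  have \<epsilon>1: "\<epsilon> = 1 \<or> \<epsilon> = - 1" using \<epsilon> by (simp add: power2_eq_1_iff)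
  have sin0: "sin t\<^sub>0 = 0" using \<epsilon> sin_squared_eq[of t\<^sub>0] t0 by simp
  have vd: "vector_derivative (brocard_curve \<epsilon> a) (at s) = brocard_velocity \<epsilon> a s" for s
    by (rule vector_derivative_at[OF deriv])
  define w where "w = (\<lambda>t. (a / (4 + (sin t)\<^sup>2)\<^sup>2) *\<^sub>R
     (\<chi> i. if i = 1 then - 4 * (5 + 2 * \<epsilon> * cos t + (cos t)\<^sup>2)
        else 2 * \<epsilon> * sin t * ((cos t)\<^sup>2 + 8 * \<epsilon> * cos t - 5) / (1 - \<epsilon> * cos t)) :: real^2)"
  have c0: "1 - \<epsilon> * cos t\<^sub>0 \<noteq> 0" using \<epsilon> t0 by (simp add: power2_eq_square)
  \<comment> \<open>At \<open>t\<^sub>0\<close> the field \<open>w\<close> is a negative multiple of the first unit vector.\<close>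
  have w0: "w t\<^sub>0 \<noteq> 0"
    using a \<epsilon>1 by (auto simp: w_def t0 sin0 vec2_eq_iff)
  have w_lim: "(w \<longlongrightarrow> w t\<^sub>0) (at t\<^sub>0)"
  proof -
    have "((\<lambda>t. if i = 1 then - 4 * (5 + 2 * \<epsilon> * cos t + (cos t)\<^sup>2)
        else 2 * \<epsilon> * sin t * ((cos t)\<^sup>2 + 8 * \<epsilon> * cos t - 5) / (1 - \<epsilon> * cos t))
      \<longlongrightarrow> (if i = 1 then - 4 * (5 + 2 * \<epsilon> * cos t\<^sub>0 + (cos t\<^sub>0)\<^sup>2)
        else 2 * \<epsilon> * sin t\<^sub>0 * ((cos t\<^sub>0)\<^sup>2 + 8 * \<epsilon> * cos t\<^sub>0 - 5) / (1 - \<epsilon> * cos t\<^sub>0))) (at t\<^sub>0)"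
      for i :: 2
      using c0 by (cases "i = 1") (auto intro!: tendsto_intros)
    then show ?thesis
      unfolding w_def using four_plus_square(2)[of "sin t\<^sub>0"]
      by (intro tendsto_scaleR tendsto_vec_lambda tendsto_intros) auto
  qed
  have vel: "\<forall>\<^sub>F s in at t\<^sub>0. brocard_velocity \<epsilon> a s = sin s *\<^sub>R w s"
  proof -
    have "((\<lambda>s. 1 - \<epsilon> * cos s) \<longlongrightarrow> 1 - \<epsilon> * cos t\<^sub>0) (at t\<^sub>0)" by (intro tendsto_intros)
    from tendsto_imp_eventually_ne[OF this c0] show ?thesis
    proof eventually_elim
      case (elim s)
      have "(1 + \<epsilon> * cos s) * (1 - \<epsilon> * cos s) = 1 - \<epsilon>\<^sup>2 * (cos s)\<^sup>2"
        by (simp add: algebra_simps power2_eq_square)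
      then have "1 + \<epsilon> * cos s = (sin s)\<^sup>2 / (1 - \<epsilon> * cos s)"
        using elim by (simp add: \<epsilon> sin_squared_eq field_simps)
      then show ?case
        by (simp add: brocard_velocity_def w_def vec2_eq_iff power2_eq_square)
           (simp add: algebra_simps add_divide_distrib diff_divide_distrib)
    qed
  qed
  have sin_shift: "sin s = - \<epsilon> * sin (s - t\<^sub>0)" for s
  proof -
    have "sin (s - t\<^sub>0) = sin s * (- \<epsilon>)" by (simp add: sin_diff sin0 t0)
    then show ?thesis using \<epsilon>1 by auto
  qed
  have sgn_lim: "((\<lambda>s. sgn (w s)) \<longlongrightarrow> sgn (w t\<^sub>0)) (at t\<^sub>0)"
    using w_lim w0 by (rule tendsto_sgn)
  have right: "((\<lambda>s. sgn (brocard_velocity \<epsilon> a s)) \<longlongrightarrow> (- \<epsilon>) *\<^sub>R sgn (w t\<^sub>0)) (at_right t\<^sub>0)"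
  proof (rule Lim_transform_eventually)
    show "((\<lambda>s. (- \<epsilon>) *\<^sub>R sgn (w s)) \<longlongrightarrow> (- \<epsilon>) *\<^sub>R sgn (w t\<^sub>0)) (at_right t\<^sub>0)"
      by (intro tendsto_intros tendsto_mono[OF at_le sgn_lim]) auto
    have "\<forall>\<^sub>F s in at_right t\<^sub>0. s \<in> {t\<^sub>0<..<t\<^sub>0 + pi}" by (rule eventually_at_right_real) simp
    moreover have "\<forall>\<^sub>F s in at_right t\<^sub>0. brocard_velocity \<epsilon> a s = sin s *\<^sub>R w s"
      using vel by (rule filter_leD[OF at_le, rotated]) auto
    ultimately show "\<forall>\<^sub>F s in at_right t\<^sub>0. (- \<epsilon>) *\<^sub>R sgn (w s) = sgn (brocard_velocity \<epsilon> a s)"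
    proof eventually_elim
      case (elim s)
      then have "sin (s - t\<^sub>0) > 0" by (intro sin_gt_zero) auto
      then have "sgn (sin s) = - \<epsilon>" using \<epsilon>1 by (subst sin_shift) auto
      then show ?case by (simp add: elim sgn_scaleR)
    qed
  qed
  have left: "((\<lambda>s. sgn (brocard_velocity \<epsilon> a s)) \<longlongrightarrow> \<epsilon> *\<^sub>R sgn (w t\<^sub>0)) (at_left t\<^sub>0)"
  proof (rule Lim_transform_eventually)
    show "((\<lambda>s. \<epsilon> *\<^sub>R sgn (w s)) \<longlongrightarrow> \<epsilon> *\<^sub>R sgn (w t\<^sub>0)) (at_left t\<^sub>0)"
      by (intro tendsto_intros tendsto_mono[OF at_le sgn_lim]) auto
    have "\<forall>\<^sub>F s in at_left t\<^sub>0. s \<in> {t\<^sub>0 - pi<..<t\<^sub>0}" by (rule eventually_at_left_real) simp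
    moreover have "\<forall>\<^sub>F s in at_left t\<^sub>0. brocard_velocity \<epsilon> a s = sin s *\<^sub>R w s"
      using vel by (rule filter_leD[OF at_le, rotated]) auto
    ultimately show "\<forall>\<^sub>F s in at_left t\<^sub>0. \<epsilon> *\<^sub>R sgn (w s) = sgn (brocard_velocity \<epsilon> a s)"
    proof eventually_elim
      case (elim s)
      then have "sin (t\<^sub>0 - s) > 0" by (intro sin_gt_zero) auto
      then have "sin (s - t\<^sub>0) < 0" by (metis minus_diff_eq neg_0_less_iff_less sin_minus)
      then have "sgn (sin s) = \<epsilon>" using \<epsilon>1 by (subst sin_shift) auto
      then show ?case by (simp add: elim sgn_scaleR)
    qed
  qed
  show ?thesis
    unfolding cusp_at_def vd
  proof (intro conjI exI)
    show "\<forall>\<^sub>F s in nhds t\<^sub>0. brocard_curve \<epsilon> a differentiable at s"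
      by (intro always_eventually allI differentiableI_vector[OF deriv])
    show "(1::real) > 0" by simp
    show "inj_on (brocard_curve \<epsilon> a) {t\<^sub>0 - 1..t\<^sub>0 + 1}"
    proof (rule inj_onI)
      fix x y assume xy: "x \<in> {t\<^sub>0 - 1..t\<^sub>0 + 1}" "y \<in> {t\<^sub>0 - 1..t\<^sub>0 + 1}"
        "brocard_curve \<epsilon> a x = brocard_curve \<epsilon> a y"
      then have "cos x = cos y \<and> sin x = sin y"
        unfolding brocard_curve_def by (intro brocard_xy_inject[OF a \<epsilon>]) auto
      then show "x = y" using xy(1,2) pi_gt3 by (auto intro: cos_sin_eq_imp_eq[of x y])
    qed
    show "brocard_velocity \<epsilon> a t\<^sub>0 = 0"
      using \<epsilon> by (simp add: brocard_velocity_def sin0 t0 vec2_eq_iff power2_eq_square)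
    show "norm ((- \<epsilon>) *\<^sub>R sgn (w t\<^sub>0)) = 1"
      using w0 \<epsilon>1 by (auto simp: norm_sgn)
    show "((\<lambda>s. sgn (brocard_velocity \<epsilon> a s)) \<longlongrightarrow> - ((- \<epsilon>) *\<^sub>R sgn (w t\<^sub>0))) (at_left t\<^sub>0)"
      using left by simp
  qed (rule right)
qed

text \<open>The first curve does pass through \<open>(a, 0)\<close>, at \<open>cos t = 1\<close>, but with nonzero velocity.
  Hence only the second curve has a cusp there.\<close>

lemma brocard_curve_no_cusp:
  assumes a: "a > 0"
  shows "\<not> has_cusp (brocard_curve 1 a) (vector [a, 0])"
proof
  assume "has_cusp (brocard_curve 1 a) (vector [a, 0])"
  then obtain t where t: "brocard_curve 1 a t = vector [a, 0]" and cusp: "cusp_at (brocard_curve 1 a) t"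
    unfolding has_cusp_def by blast
  have "a * (4 * cos t - (sin t)\<^sup>2) / (4 + (sin t)\<^sup>2) = a"
    using brocard_curve_nth(1)[of 1 a t] by (simp add: t)
  then have "a * (4 * cos t - (sin t)\<^sup>2) = a * (4 + (sin t)\<^sup>2)"
    using four_plus_square(2)[of "sin t"] by (simp add: field_simps)
  then have "4 * cos t - (sin t)\<^sup>2 = 4 + (sin t)\<^sup>2" using a by simp
  then have "cos t = 1" using zero_le_power2[of "sin t"] cos_le_one[of t] by linarith
  then have "brocard_velocity 1 a t \<noteq> 0"
    using a four_plus_square(2)[of "sin t"] by (simp add: brocard_velocity_def vec2_eq_iff)
  moreover have "brocard_velocity 1 a t = 0"
    using cusp vector_derivative_at[OF brocard_curve_has_vector_derivative[of 1 a t]]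
    by (simp add: cusp_at_def)
  ultimately show False by contradiction
qed

section \<open>The quartic\<close>

text \<open>In terms of the horizontal offset \<open>u = a - x\<close> from the cusp \<open>(a, 0)\<close>, dividing by
  \<open>a\<^sup>2 u\<^sup>2\<close> turns the quartic into \<open>c\<^sup>2 + s\<^sup>2 - 1\<close> for
  \<open>c = 1 - (u\<^sup>2 + y\<^sup>2) / (a u)\<close> and \<open>s = 2 y / u\<close>. These are the values that the chord from the
  cusp assigns to the point \<open>(x, y)\<close>.\<close>

lemma brocard_quartic_at_cusp:
  "brocard_quartic a (a - u) y = (a * u - u\<^sup>2 - y\<^sup>2)\<^sup>2 + 4 * a\<^sup>2 * y\<^sup>2 - a\<^sup>2 * u\<^sup>2"
  unfolding brocard_quartic_def
  by (simp add: algebra_simps power2_eq_square power3_eq_cube power4_eq_xxxx)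

text \<open>A real quartic might have further branches or isolated real points. Off the vertical
  line \<open>x = a\<close> the chord from the cusp shows directly that every zero is on the curve, and on that
  line the quartic reduces to \<open>y\<^sup>4 + 4 a\<^sup>2 y\<^sup>2\<close>, which vanishes only at the cusp.\<close>

lemma range_brocard_curve_quartic:
  assumes a: "a > 0"
  shows "brocard_curve (- 1) a ` {0..<2*pi} = {vector [x, y] | x y. brocard_quartic a x y = 0}"
  unfolding range_brocard_curve
proof (intro equalityI subsetI)
  fix v assume "v \<in> {brocard_xy (- 1) a c s | c s. c\<^sup>2 + s\<^sup>2 = 1}"
  then obtain c s where v: "v = brocard_xy (- 1) a c s" and cs: "c\<^sup>2 + s\<^sup>2 = 1" by blast
  define u where "u = a - v $ 1"
  have u: "u * (4 + s\<^sup>2) = 4 * a * (1 - c)"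
    using brocard_xy_chord(1)[of "- 1" a c s] four_plus_square(2)[of s] by (simp add: u_def v)
  have y: "v $ 2 = s * u / 2"
    using brocard_xy_chord(2)[of "- 1" a c s] by (simp add: u_def v)
  have "a * u - u\<^sup>2 - (v $ 2)\<^sup>2 = u * (a - u * (4 + s\<^sup>2) / 4)"
    by (simp add: y field_simps power2_eq_square)
  also have "\<dots> = a * u * c" unfolding u by (simp add: field_simps)
  finally have base: "a * u - u\<^sup>2 - (v $ 2)\<^sup>2 = a * u * c" .
  have "v $ 1 = a - u" by (simp add: u_def)
  then have "brocard_quartic a (v $ 1) (v $ 2) = (a * u * c)\<^sup>2 + 4 * a\<^sup>2 * (v $ 2)\<^sup>2 - a\<^sup>2 * u\<^sup>2"
    by (simp only: brocard_quartic_at_cusp base)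
  also have "\<dots> = a\<^sup>2 * u\<^sup>2 * (c\<^sup>2 + s\<^sup>2 - 1)"
    by (simp add: y algebra_simps power2_eq_square)
  finally have "brocard_quartic a (v $ 1) (v $ 2) = 0" using cs by simp
  moreover have "v = vector [v $ 1, v $ 2]" by (simp add: vec2_eq_iff)
  ultimately show "v \<in> {vector [x, y] | x y. brocard_quartic a x y = 0}" by blast
next
  fix v :: "real^2" assume "v \<in> {vector [x, y] | x y. brocard_quartic a x y = 0}"
  then obtain x y where v: "v = vector [x, y]" and q: "brocard_quartic a x y = 0" by blast
  define u where "u = a - x"
  have q': "(a * u - u\<^sup>2 - y\<^sup>2)\<^sup>2 + 4 * a\<^sup>2 * y\<^sup>2 = a\<^sup>2 * u\<^sup>2"
    using q brocard_quartic_at_cusp[of a u y] by (simp add: u_def)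
  show "v \<in> {brocard_xy (- 1) a c s | c s. c\<^sup>2 + s\<^sup>2 = 1}"
  proof (cases "u = 0")
    case True
    then have "(y\<^sup>2)\<^sup>2 + 4 * a\<^sup>2 * y\<^sup>2 = 0" using q' by simp
    then have "y = 0" using a by (simp add: add_nonneg_eq_0_iff)
    then have "v = brocard_xy (- 1) a 1 0"
      using True by (simp add: v u_def brocard_xy_def vec2_eq_iff)
    then show ?thesis by force
  next
    case False
    define c s where "c = 1 - (u\<^sup>2 + y\<^sup>2) / (a * u)" and "s = 2 * y / u"
    have cu: "a * u * c = a * u - u\<^sup>2 - y\<^sup>2" and su: "s * u = 2 * y"
      using False a by (simp_all add: c_def s_def field_simps)
    have "(a * u)\<^sup>2 * (c\<^sup>2 + s\<^sup>2) = (a * u * c)\<^sup>2 + a\<^sup>2 * (s * u)\<^sup>2"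
      by (simp add: algebra_simps power2_eq_square)
    also have "\<dots> = (a * u - u\<^sup>2 - y\<^sup>2)\<^sup>2 + 4 * a\<^sup>2 * y\<^sup>2"
      unfolding cu su by (simp add: power_mult_distrib)
    also have "\<dots> = (a * u)\<^sup>2 * 1" by (simp add: q' power_mult_distrib)
    finally have cs: "c\<^sup>2 + s\<^sup>2 = 1" using False a by simp
    have "u * (4 * a * (1 - c)) = 4 * (a * u - a * u * c)" by (simp add: algebra_simps)
    also have "\<dots> = 4 * u\<^sup>2 + (s * u)\<^sup>2" unfolding cu su by (simp add: power_mult_distrib)
    also have "\<dots> = u * (u * (4 + s\<^sup>2))" by (simp add: algebra_simps power2_eq_square)
    finally have "4 * a * (1 - c) = u * (4 + s\<^sup>2)" using False by simp
    then have u: "a * (4 * (1 - c) / (4 + s\<^sup>2)) = u"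
      using four_plus_square(2)[of s] by (simp add: field_simps)
    have x: "brocard_xy (- 1) a c s $ 1 = x"
      using brocard_xy_chord(1)[of "- 1" a c s] u by (simp add: u_def)
    have "brocard_xy (- 1) a c s $ 2 = y"
      using brocard_xy_chord(2)[of "- 1" a c s] su by (simp add: x u_def)
    with x have "v = brocard_xy (- 1) a c s" by (simp add: v vec2_eq_iff)
    then show ?thesis using cs by blast
  qed
qed

section \<open>The reflection that exchanges the curves\<close>

definition reflect_y_axis :: "real^2 \<Rightarrow> real^2" where
  "reflect_y_axis v = vector [- v $ 1, v $ 2]"

lemma orientation_reversing_isometry_reflect_y_axis:
  "orientation_reversing_isometry reflect_y_axis"
proof -
  have "dist (reflect_y_axis v) (reflect_y_axis w) = dist v w" for v w
  proof -
    have "(- v $ 1 + w $ 1)\<^sup>2 = (v $ 1 - w $ 1)\<^sup>2" by (simp add: power2_eq_square algebra_simps)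
    then show ?thesis
      by (simp add: reflect_y_axis_def dist_norm norm_vec_def L2_set_def sum_2)
  qed
  then show ?thesis
    by (simp add: orientation_reversing_isometry_def reflect_y_axis_def det_2 matrix_def axis_def)
qed

text \<open>The reflection exchanges the two fixed vertices, hence the two Brocard points, and maps
  the third vertex \<open>a (c, s)\<close> to \<open>a (- c, s)\<close>.\<close>

lemma reflect_y_axis_range_brocard_curve:
  "reflect_y_axis ` brocard_curve 1 a ` {0..<2*pi} = brocard_curve (- 1) a ` {0..<2*pi}"
proof -
  have refl: "reflect_y_axis (brocard_xy 1 a c s) = brocard_xy (- 1) a (- c) s" for c s
    by (simp add: reflect_y_axis_def brocard_xy_def vec2_eq_iff
        algebra_simps diff_divide_distrib)
  show ?thesis
    unfolding range_brocard_curve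
  proof (intro equalityI subsetI)
    fix v assume "v \<in> {brocard_xy (- 1) a c s | c s. c\<^sup>2 + s\<^sup>2 = 1}"
    then obtain c s where "v = reflect_y_axis (brocard_xy 1 a (- c) s)" "(- c)\<^sup>2 + s\<^sup>2 = 1"
      by (auto simp: refl)
    then show "v \<in> reflect_y_axis ` {brocard_xy 1 a c s | c s. c\<^sup>2 + s\<^sup>2 = 1}" by blast
  qed (force simp: refl)
qed

section \<open>The loci of the Brocard points\<close>

theorem proposition3:
  fixes a :: real and V1 V2 :: "real^2" and P \<Gamma>1 \<Gamma>2 :: "real \<Rightarrow> real^2"
  assumes "a > 0"
  defines "V1 \<equiv> vector [- a, 0]"
    and "V2 \<equiv> vector [a, 0]"
    and "P \<equiv> \<lambda>t. vector [a * cos t, a * sin t]"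
    and "\<Gamma>1 \<equiv> point_curve brocard_point1 V1 V2 P"
    and "\<Gamma>2 \<equiv> point_curve brocard_point2 V1 V2 P"
  shows "(\<forall>\<Gamma>\<in>{\<Gamma>1, \<Gamma>2}. continuous_on {0..2*pi} \<Gamma> \<and> \<Gamma> 0 = \<Gamma> (2*pi) \<and>
            enclosed_area \<Gamma> = pi * a^2 / sqrt 5) \<and>
         (\<exists>f. orientation_reversing_isometry f \<and>
            f ` (\<Gamma>1 ` {0..<2*pi}) = \<Gamma>2 ` {0..<2*pi}) \<and>
         (has_cusp \<Gamma>1 V1 \<and> has_cusp \<Gamma>2 V2 \<or> has_cusp \<Gamma>2 V1 \<and> has_cusp \<Gamma>1 V2) \<and>
         (\<forall>\<Gamma>\<in>{\<Gamma>1, \<Gamma>2}. has_cusp \<Gamma> V2 \<longrightarrow>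
            \<Gamma> ` {0..<2*pi} = {vector [x, y] | x y. brocard_quartic a x y = 0}) \<and>
         (\<forall>x y. brocard_quartic 1 x y =
            x^4 - 2 * x^3 + 2 * y^2 * x^2 + 2 * x - 2 * y^2 * x - 1 + y^4 + 4 * y^2)"
proof -
  note a = \<open>a > 0\<close>
  have \<Gamma>1: "\<Gamma>1 = brocard_curve 1 a"
    unfolding \<Gamma>1_def V1_def V2_def P_def
    by (rule point_curve_eq_brocard_curve[OF a]) (simp_all add: brocard_thales(1)[OF a])
  have \<Gamma>2: "\<Gamma>2 = brocard_curve (- 1) a"
    unfolding \<Gamma>2_def V1_def V2_def P_def
    by (rule point_curve_eq_brocard_curve[OF a]) (simp_all add: brocard_thales(2)[OF a])
  have closed_curve: "continuous_on {0..2*pi} (brocard_curve \<epsilon> a) \<and>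
      brocard_curve \<epsilon> a 0 = brocard_curve \<epsilon> a (2*pi) \<and>
      enclosed_area (brocard_curve \<epsilon> a) = pi * a^2 / sqrt 5" if "\<epsilon>\<^sup>2 = 1" for \<epsilon>
    using that by (simp add: continuous_on_brocard_curve enclosed_area_brocard_curve)
       (simp add: brocard_curve_def)
  have cusp1: "has_cusp \<Gamma>1 V1"
    unfolding has_cusp_def \<Gamma>1
    by (rule bexI[of _ pi])
       (auto simp: V1_def vec2_eq_iff brocard_curve_nth intro!: brocard_curve_cusp_at a)
  have cusp2: "has_cusp \<Gamma>2 V2"
    unfolding has_cusp_def \<Gamma>2
    by (rule bexI[of _ 0])
       (auto simp: V2_def vec2_eq_iff brocard_curve_nth intro!: brocard_curve_cusp_at a)
  have quartic1: "brocard_quartic 1 x y =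
      x^4 - 2 * x^3 + 2 * y^2 * x^2 + 2 * x - 2 * y^2 * x - 1 + y^4 + 4 * y^2" for x y
    by (simp add: brocard_quartic_def algebra_simps power2_eq_square power3_eq_cube power4_eq_xxxx)
  show ?thesis
  proof (intro conjI)
    show "\<forall>\<Gamma>\<in>{\<Gamma>1, \<Gamma>2}. continuous_on {0..2*pi} \<Gamma> \<and> \<Gamma> 0 = \<Gamma> (2*pi) \<and>
        enclosed_area \<Gamma> = pi * a^2 / sqrt 5"
      using closed_curve[of 1] closed_curve[of "- 1"] by (simp add: \<Gamma>1 \<Gamma>2)
    show "\<exists>f. orientation_reversing_isometry f \<and> f ` (\<Gamma>1 ` {0..<2*pi}) = \<Gamma>2 ` {0..<2*pi}"
      using orientation_reversing_isometry_reflect_y_axis reflect_y_axis_range_brocard_curve[of a]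
      unfolding \<Gamma>1 \<Gamma>2 by blast
    show "has_cusp \<Gamma>1 V1 \<and> has_cusp \<Gamma>2 V2 \<or> has_cusp \<Gamma>2 V1 \<and> has_cusp \<Gamma>1 V2"
      using cusp1 cusp2 by blast
    show "\<forall>\<Gamma>\<in>{\<Gamma>1, \<Gamma>2}. has_cusp \<Gamma> V2 \<longrightarrow>
        \<Gamma> ` {0..<2*pi} = {vector [x, y] | x y. brocard_quartic a x y = 0}"
      using brocard_curve_no_cusp[OF a] range_brocard_curve_quartic[OF a]
      by (simp add: \<Gamma>1 \<Gamma>2 V2_def)
  qed (use quartic1 in blast)
qed

end
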